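(* Let $t\ge 2$ be an integer and let $K_t/e$ denote the graph obtained from the complete graph $K_t$ by deleting one edge. If $\Gamma$ is a finite simple graph with $A(\Gamma;x)=A(K_t/e;x)$, then $\Gamma$ is isomorphic to $K_t/e$.
   Context: All graphs are finite and simple with at least one vertex. For a graph $\Gamma=(V,E)$ of order $n$, a vertex $v$ and $X\subseteq V$, let $\delta_X(v)$ be the number of neighbours of $v$ in $X$, $\delta_1$ the maximum degree, and $\bar S=V\setminus S$. Let $\mathcal{K}=[-\delta_1,\delta_1]\cap\mathbb{Z}$. A nonempty $S\subseteq V$ is a defensive $k$-alliance if $\delta_S(v)\ge\delta_{\bar S}(v)+k$ for all $v\in S$. The exact index of alliance of a nonempty $S$ is $k_S=\max\{k\in\mathcal{K}: S \text{ is a defensive } k\text{-alliance}\}$ (equivalently $k_S=\min_{v\in S}(\delta_S(v)-\delta_{\bar S}(v))$). The alliance polynomial is $A(\Gamma;x)=\sum_{S} x^{n+k_S}$, the sum over all nonempty $S\subseteq V$ whose induced subgraph $\langle S\rangle$ is connected. *)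

theory Defs
  imports
    "Graph_Theory.Graph_Theory"
    "HOL-Computational_Algebra.Polynomial"
begin

text \<open>
  A finite simple graph is a \<^locale>\<open>pair_graph\<close>: finite, loop-free and symmetric, an undirected
  edge \<open>{u, v}\<close> being the pair of arcs \<open>(u, v)\<close>, \<open>(v, u)\<close>. The number of neighbours of a vertex
  is therefore its \<^const>\<open>out_degree\<close>.
\<close>

definition degree_in :: "('a, 'b) pre_digraph \<Rightarrow> 'a set \<Rightarrow> 'a \<Rightarrow> nat" where
  "degree_in G X v = card {u \<in> X. v \<rightarrow>\<^bsub>G\<^esub> u}"

definition max_degree :: "('a, 'b) pre_digraph \<Rightarrow> nat" where
  "max_degree G = Max (out_degree G ` verts G)"

definition defensive_alliance :: "('a, 'b) pre_digraph \<Rightarrow> int \<Rightarrow> 'a set \<Rightarrow> bool" where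
  "defensive_alliance G k S \<longleftrightarrow> S \<noteq> {} \<and> S \<subseteq> verts G \<and>
     (\<forall>v\<in>S. int (degree_in G S v) \<ge> int (degree_in G (verts G - S) v) + k)"

definition alliance_index :: "('a, 'b) pre_digraph \<Rightarrow> 'a set \<Rightarrow> int" where
  "alliance_index G S =
     Max {k \<in> {- int (max_degree G)..int (max_degree G)}. defensive_alliance G k S}"

text \<open>
  The conversion by \<^const>\<open>nat\<close> below loses nothing: the index is at least
  \<open>- int (max_degree G)\<close>, and the maximum degree of a simple graph is less than its order.
  The name \<open>connected\<close> is qualified because it also denotes topological connectedness.
\<close>

definition alliance_poly :: "('a, 'b) pre_digraph \<Rightarrow> int poly" where
  "alliance_poly G =
     (\<Sum>S | S \<subseteq> verts G \<and> S \<noteq> {} \<and> Digraph_Component.connected (G \<restriction> S).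
        monom 1 (nat (int (card (verts G)) + alliance_index G S)))"

definition delete_edge :: "'a pair_pre_digraph \<Rightarrow> 'a \<Rightarrow> 'a \<Rightarrow> 'a pair_pre_digraph" where
  "delete_edge G u v = G\<lparr>parcs := parcs G - {(u, v), (v, u)}\<rparr>"

end

theory Submission
  imports Defs
begin

text \<open>
  Since \<open>k\<^sub>S\<close> is the minimum of \<open>2 \<delta>\<^sub>S(v) - \<delta>(v)\<close> over \<open>v \<in> S\<close>, all exponents of the alliance
  polynomial lie between \<open>n - \<delta>\<^sub>1\<close> and \<open>n + \<delta>\<^sub>1\<close>, and the sets with exponent \<open>n - \<delta>\<^sub>1\<close> are exactly
  the singletons of vertices of maximum degree. For \<open>t \<ge> 3\<close> the lowest term of the polynomial of
  \<open>K\<^sub>t/e\<close> is \<open>(t - 2) x\<close> and its degree is \<open>2 t - 2\<close>, so \<open>\<Gamma>\<close> has exactly \<open>t - 2\<close> dominating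
  vertices. From \<open>2 t - 2 \<le> n + \<delta>\<^sub>1 = 2 n - 1\<close> we get \<open>t \<le> n\<close>. The minimum degree of \<open>\<Gamma>\<close> is at
  least \<open>t - 2\<close> and it is the index of the whole vertex set, so \<open>n + (t - 2) \<le> 2 t - 2\<close>, that is
  \<open>n \<le> t\<close>. Hence just two vertices are not dominating, and they can only miss each other. For
  \<open>t = 2\<close> the polynomial is \<open>2 x\<^sup>2\<close>, which makes every vertex of \<open>\<Gamma>\<close> one of the two of maximum degree.
\<close>

section \<open>Connected sets, vertices of maximum degree and degrees in a set\<close>

definition connected_sets :: "('a, 'b) pre_digraph \<Rightarrow> 'a set set" where
  "connected_sets G = {S. S \<subseteq> verts G \<and> S \<noteq> {} \<and> Digraph_Component.connected (G \<restriction> S)}"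

definition max_degree_verts :: "('a, 'b) pre_digraph \<Rightarrow> 'a set" where
  "max_degree_verts G = {v \<in> verts G. out_degree G v = max_degree G}"

context graph
begin

lemma finite_connected_sets: "finite (connected_sets G)"
  by (rule finite_subset[of _ "Pow (verts G)"]) (auto simp: connected_sets_def)

text \<open>The degree counts arcs while \<open>degree_in\<close> counts neighbours. Without
  parallel arcs, \<open>head G\<close> maps the arcs leaving \<open>v\<close> bijectively to its
  neighbours.\<close>

lemma degree_in_verts: "degree_in G (verts G) v = out_degree G v"
proof -
  have "bij_betw (head G) (out_arcs G v) {u \<in> verts G. v \<rightarrow> u}"
    unfolding bij_betw_def
  proof
    show "inj_on (head G) (out_arcs G v)"
      by (auto intro!: inj_onI no_multi_arcs simp: arc_to_ends_def)
    show "head G ` out_arcs G v = {u \<in> verts G. v \<rightarrow> u}"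
      by (auto simp: arcs_ends_conv image_iff)
  qed
  then show ?thesis
    by (simp add: degree_in_def out_degree_def bij_betw_same_card)
qed

lemma degree_in_add_compl:
  assumes "S \<subseteq> verts G"
  shows "degree_in G S v + degree_in G (verts G - S) v = out_degree G v"
proof -
  have "{u \<in> verts G. v \<rightarrow> u} = {u \<in> S. v \<rightarrow> u} \<union> {u \<in> verts G - S. v \<rightarrow> u}"
    using assms by auto
  moreover have "finite S" using assms finite_verts finite_subset by blast
  ultimately have "degree_in G (verts G) v = degree_in G S v + degree_in G (verts G - S) v"
    unfolding degree_in_def by (simp add: card_Un_disjoint disjoint_iff)
  then show ?thesis by (simp add: degree_in_verts)
qed

lemma degree_in_less_card:
  assumes "finite S" "v \<in> S"
  shows "degree_in G S v < card S"
  unfolding degree_in_def using assms adj_not_same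
  by (intro psubset_card_mono) auto

lemma out_degree_less_order: "v \<in> verts G \<Longrightarrow> out_degree G v < card (verts G)"
  using degree_in_less_card[of "verts G" v] by (simp add: degree_in_verts)

lemma out_degree_le_max_degree: "v \<in> verts G \<Longrightarrow> out_degree G v \<le> max_degree G"
  by (simp add: max_degree_def)

lemma max_degree_attained:
  assumes "verts G \<noteq> {}"
  obtains v where "v \<in> verts G" "out_degree G v = max_degree G"
proof -
  have "max_degree G \<in> out_degree G ` verts G"
    using assms unfolding max_degree_def by (intro Max_in) auto
  then show thesis using that by auto
qed

lemma max_degree_less_order:
  assumes "verts G \<noteq> {}"
  shows "max_degree G < card (verts G)"
proof -
  obtain v where "v \<in> verts G" "out_degree G v = max_degree G"
    using max_degree_attained[OF assms] .
  then show ?thesis using out_degree_less_order[of v] by simp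
qed

text \<open>The neighbours of \<open>v\<close> form a subset of \<open>verts G - {v}\<close>, so the
  count is maximal only if the sets agree. This turns a degree condition into domination.\<close>

lemma out_degree_eq_order_minus_1_iff:
  assumes "v \<in> verts G"
  shows "out_degree G v = card (verts G) - 1 \<longleftrightarrow> (\<forall>w \<in> verts G - {v}. v \<rightarrow> w)"
proof -
  have sub: "{u \<in> verts G. v \<rightarrow> u} \<subseteq> verts G - {v}"
    using adj_not_same by auto
  have "out_degree G v = card (verts G) - 1 \<longleftrightarrow>
      card {u \<in> verts G. v \<rightarrow> u} = card (verts G - {v})"
    using assms by (simp add: degree_in_verts[symmetric] degree_in_def)
  also have "\<dots> \<longleftrightarrow> {u \<in> verts G. v \<rightarrow> u} = verts G - {v}"
    using card_subset_eq[OF finite_Diff[OF finite_verts] sub] by argo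
  also have "\<dots> \<longleftrightarrow> (\<forall>w \<in> verts G - {v}. v \<rightarrow> w)"
    using sub by auto
  finally show ?thesis .
qed

section \<open>The alliance index as a minimum\<close>

text \<open>Eliminating the degree into the complement, the alliance condition at \<open>v\<close>
  becomes an upper bound on \<open>k\<close>. The least of these bounds has absolute value at most
  the maximum degree, so the restriction of \<open>k\<close> to that window does not change the
  maximum.\<close>

lemma alliance_index_eq_Min:
  assumes "S \<subseteq> verts G" "S \<noteq> {}"
  shows "alliance_index G S =
    Min ((\<lambda>v. 2 * int (degree_in G S v) - int (out_degree G v)) ` S)" (is "_ = Min (?f ` S)")
proof -
  let ?D = "int (max_degree G)"
  have fin: "finite (?f ` S)" and ne: "?f ` S \<noteq> {}"
    using assms finite_subset[OF _ finite_verts] by auto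
  have split: "int (out_degree G v) = int (degree_in G S v) + int (degree_in G (verts G - S) v)" for v
    using degree_in_add_compl[OF assms(1), of v] by simp
  have bound: "\<bar>?f v\<bar> \<le> ?D" if "v \<in> S" for v
    using split[of v] out_degree_le_max_degree[of v] that assms(1) by auto
  have "defensive_alliance G k S \<longleftrightarrow> (\<forall>v \<in> S. k \<le> ?f v)" for k
    using assms split unfolding defensive_alliance_def by (smt (verit, best))
  then have alliance_iff: "defensive_alliance G k S \<longleftrightarrow> k \<le> Min (?f ` S)" for k
    using Min_ge_iff[OF fin ne, of k] by simp
  have Min_bounds: "- ?D \<le> Min (?f ` S)" "Min (?f ` S) \<le> ?D"
    using Min_in[OF fin ne] bound by fastforce+
  show ?thesis
    unfolding alliance_index_def alliance_iff
  proof (rule Max_eqI)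
    show "finite {k \<in> {- ?D..?D}. k \<le> Min (?f ` S)}"
      by (rule finite_subset[of _ "{- ?D..?D}"]) auto
  qed (use Min_bounds in simp_all)
qed

lemma alliance_index_le:
  assumes "S \<subseteq> verts G" "v \<in> S"
  shows "alliance_index G S \<le> 2 * int (degree_in G S v) - int (out_degree G v)"
  using assms finite_subset[OF _ finite_verts, of S]
  by (subst alliance_index_eq_Min) (auto intro!: Min_le)

lemma alliance_index_attained:
  assumes "S \<subseteq> verts G" "S \<noteq> {}"
  obtains v where "v \<in> S"
    "alliance_index G S = 2 * int (degree_in G S v) - int (out_degree G v)"
proof -
  have "alliance_index G S \<in> (\<lambda>v. 2 * int (degree_in G S v) - int (out_degree G v)) ` S"
    using assms finite_subset[OF _ finite_verts, of S]
    unfolding alliance_index_eq_Min[OF assms] by (intro Min_in) auto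
  then show thesis using that by auto
qed

lemma degree_in_le_out_degree: "S \<subseteq> verts G \<Longrightarrow> degree_in G S v \<le> out_degree G v"
  using degree_in_add_compl[of S v] by simp

lemma alliance_index_bounds:
  assumes "S \<subseteq> verts G" "S \<noteq> {}"
  shows "- int (max_degree G) \<le> alliance_index G S" "alliance_index G S \<le> int (max_degree G)"
proof -
  obtain v where v: "v \<in> S"
    "alliance_index G S = 2 * int (degree_in G S v) - int (out_degree G v)"
    using alliance_index_attained[OF assms] .
  then have "v \<in> verts G" using assms by auto
  then show "- int (max_degree G) \<le> alliance_index G S"
    "alliance_index G S \<le> int (max_degree G)"
    using v(2) out_degree_le_max_degree[of v] degree_in_le_out_degree[OF assms(1), of v] by auto
qed

lemma alliance_index_singleton:
  assumes "v \<in> verts G"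
  shows "alliance_index G {v} = - int (out_degree G v)"
proof -
  have "degree_in G {v} v = 0"
    using degree_in_less_card[of "{v}" v] by simp
  then show ?thesis
    using assms by (simp add: alliance_index_eq_Min)
qed

section \<open>Connectedness of induced subgraphs\<close>

text \<open>Any two vertices of \<open>S\<close> are joined through the centre \<open>c\<close>.
  This criterion covers both singletons and the whole vertex set of a graph with a dominating
  vertex.\<close>

lemma star_in_connected_sets:
  assumes "S \<subseteq> verts G" "c \<in> S" and star: "\<And>w. w \<in> S \<Longrightarrow> w \<noteq> c \<Longrightarrow> c \<rightarrow> w"
  shows "S \<in> connected_sets G"
proof -
  \<comment> \<open>Connectedness of a digraph means strong connectedness of its symmetric closure,
    so paths are built there.\<close>
  let ?M = "mk_symmetric (G \<restriction> S)"
  interpret I: wf_digraph "G \<restriction> S" by (rule wellformed_induce_subgraph)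
  interpret M: pair_wf_digraph ?M by (rule I.wellformed_mk_symmetric)
  have arcs: "(c, w) \<in> parcs ?M \<and> (w, c) \<in> parcs ?M" if "w \<in> S" "w \<noteq> c" for w
    using star[OF that] that assms(2) by (force simp: parcs_mk_symmetric arcs_ends_conv)
  have reach: "w \<rightarrow>\<^sup>*\<^bsub>?M\<^esub> c" "c \<rightarrow>\<^sup>*\<^bsub>?M\<^esub> w" if "w \<in> S" for w
    using arcs[OF that] that by (cases "w = c"; auto)+
  have "strongly_connected ?M"
    using assms(2) M.reachable_trans[OF reach] by (intro strongly_connectedI) auto
  then show ?thesis
    using assms by (auto simp: connected_sets_def Digraph_Component.connected_def)
qed

lemma singleton_in_connected_sets: "v \<in> verts G \<Longrightarrow> {v} \<in> connected_sets G"
  by (rule star_in_connected_sets) auto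

text \<open>A path inside \<open>S\<close> from \<open>v\<close> to another vertex of
  \<open>S\<close> has a first arc, and its end is the neighbour sought.\<close>

lemma connected_sets_neighbour:
  assumes "S \<in> connected_sets G" "v \<in> S" "S \<noteq> {v}"
  obtains w where "w \<in> S" "v \<rightarrow> w"
proof -
  let ?M = "mk_symmetric (G \<restriction> S)"
  obtain z where z: "z \<in> S" "z \<noteq> v" using assms by auto
  have "v \<rightarrow>\<^sup>*\<^bsub>?M\<^esub> z"
    using assms z by (auto simp: connected_sets_def Digraph_Component.connected_def strongly_connected_def)
  then obtain w where "(v, w) \<in> parcs ?M"
    using z by (auto elim: pre_digraph.converse_reachable_cases)
  then have "w \<in> S" "v \<rightarrow> w"
    using graph_symmetric by (auto simp: parcs_mk_symmetric arcs_ends_conv)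
  then show thesis by (rule that)
qed

section \<open>Coefficients and exponents of the alliance polynomial\<close>

lemma coeff_alliance_poly:
  "coeff (alliance_poly G) e =
    int (card {S \<in> connected_sets G. int (card (verts G)) + alliance_index G S = int e})"
proof -
  have "int (card (verts G)) + alliance_index G S \<ge> 0" if "S \<in> connected_sets G" for S
    using that alliance_index_bounds(1)[of S] max_degree_less_order
    by (force simp: connected_sets_def)
  then have "{S \<in> connected_sets G. nat (int (card (verts G)) + alliance_index G S) = e} =
      {S \<in> connected_sets G. int (card (verts G)) + alliance_index G S = int e}"
    by auto
  then show ?thesis
    unfolding alliance_poly_def connected_sets_def[symmetric]
    by (simp add: coeff_sum sum.inter_filter[symmetric] finite_connected_sets)
qed

lemma coeff_alliance_poly_nonzero_iff:
  "coeff (alliance_poly G) e \<noteq> 0 \<longleftrightarrow>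
    (\<exists>S \<in> connected_sets G. int (card (verts G)) + alliance_index G S = int e)"
  using finite_connected_sets by (auto simp: coeff_alliance_poly)

lemma alliance_poly_exponent_bounds:
  assumes "coeff (alliance_poly G) e \<noteq> 0"
  shows "card (verts G) - max_degree G \<le> e" "e \<le> card (verts G) + max_degree G"
proof -
  obtain S where S: "S \<subseteq> verts G" "S \<noteq> {}" "int (card (verts G)) + alliance_index G S = int e"
    using assms by (auto simp: coeff_alliance_poly_nonzero_iff connected_sets_def)
  then show "card (verts G) - max_degree G \<le> e" "e \<le> card (verts G) + max_degree G"
    using alliance_index_bounds[OF S(1,2)] by linarith+
qed

text \<open>Each degree is visible in the polynomial through a singleton, so an upper bound on
  exponents becomes a lower bound on degrees.\<close>

lemma alliance_poly_singleton_exponent: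
  assumes "v \<in> verts G"
  shows "coeff (alliance_poly G) (card (verts G) - out_degree G v) \<noteq> 0"
proof -
  have "int (card (verts G)) + alliance_index G {v} = int (card (verts G) - out_degree G v)"
    using assms out_degree_less_order[of v] by (simp add: alliance_index_singleton)
  then show ?thesis
    using singleton_in_connected_sets[OF assms] unfolding coeff_alliance_poly_nonzero_iff by blast
qed

text \<open>If the index of \<open>S\<close> is minus the maximum degree, the vertex
  \<open>v\<close> attaining it has no neighbour in \<open>S\<close> and has maximum degree. As
  \<open>S\<close> is connected, it is then \<open>{v}\<close>.\<close>

lemma coeff_alliance_poly_lowest:
  assumes "verts G \<noteq> {}"
  shows "coeff (alliance_poly G) (card (verts G) - max_degree G) = int (card (max_degree_verts G))"
proof -
  have "{S \<in> connected_sets G. int (card (verts G)) + alliance_index G S =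
      int (card (verts G) - max_degree G)} = (\<lambda>v. {v}) ` max_degree_verts G" (is "?L = ?R")
  proof
    show "?L \<subseteq> ?R"
    proof
      fix S assume "S \<in> ?L"
      then have S: "S \<in> connected_sets G" "S \<subseteq> verts G" "S \<noteq> {}"
        and idx: "alliance_index G S = - int (max_degree G)"
        using max_degree_less_order[OF assms] by (auto simp: connected_sets_def)
      obtain v where v: "v \<in> S"
        "alliance_index G S = 2 * int (degree_in G S v) - int (out_degree G v)"
        using alliance_index_attained[OF S(2,3)] .
      have "v \<in> verts G" using S v by auto
      have deg: "degree_in G S v = 0" "out_degree G v = max_degree G"
        using v(2) idx out_degree_le_max_degree[OF \<open>v \<in> verts G\<close>] by auto
      have "S = {v}"
      proof (rule ccontr)
        assume "S \<noteq> {v}"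
        then obtain w where "w \<in> S" "v \<rightarrow> w"
          using connected_sets_neighbour[OF S(1) v(1)] by auto
        then show False
          using deg(1) finite_subset[OF S(2) finite_verts] by (auto simp: degree_in_def)
      qed
      then show "S \<in> ?R" using deg \<open>v \<in> verts G\<close> by (auto simp: max_degree_verts_def)
    qed
    show "?R \<subseteq> ?L"
      using max_degree_less_order[OF assms]
      by (auto simp: max_degree_verts_def alliance_index_singleton singleton_in_connected_sets)
  qed
  then show ?thesis
    by (simp add: coeff_alliance_poly card_image)
qed

lemma max_degree_verts_nonempty: "verts G \<noteq> {} \<Longrightarrow> max_degree_verts G \<noteq> {}"
  using max_degree_attained by (auto simp: max_degree_verts_def)

lemma finite_max_degree_verts: "finite (max_degree_verts G)"
  by (simp add: max_degree_verts_def)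

lemma coeff_alliance_poly_lowest_nonzero:
  "verts G \<noteq> {} \<Longrightarrow> coeff (alliance_poly G) (card (verts G) - max_degree G) \<noteq> 0"
  by (simp add: coeff_alliance_poly_lowest max_degree_verts_nonempty finite_max_degree_verts)

text \<open>The dominating vertex \<open>c\<close> makes \<open>verts G\<close> connected, and the
  index of \<open>verts G\<close> is the minimum degree. That \<open>v\<close> has minimum degree is
  not recorded: the lemma is applied where a lower bound holds for all degrees.\<close>

lemma alliance_poly_min_degree_exponent:
  assumes "c \<in> verts G" "\<And>w. w \<in> verts G \<Longrightarrow> w \<noteq> c \<Longrightarrow> c \<rightarrow> w"
  obtains v where "v \<in> verts G" "coeff (alliance_poly G) (card (verts G) + out_degree G v) \<noteq> 0"
proof -
  obtain v where "v \<in> verts G" "alliance_index G (verts G) = int (out_degree G v)"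
    using alliance_index_attained[of "verts G"] assms(1) by (auto simp: degree_in_verts)
  moreover have "verts G \<in> connected_sets G"
    using assms by (intro star_in_connected_sets[of _ c]) auto
  ultimately show thesis
    using that[of v] unfolding coeff_alliance_poly_nonzero_iff by force
qed

end

text \<open>Each of the two lowest exponents occurs in the other polynomial as well, so each bounds
  the other from below. Equality of the coefficients there follows.\<close>

lemma alliance_poly_eq_lowest:
  assumes "graph G" "verts G \<noteq> {}" "graph H" "verts H \<noteq> {}"
    and "alliance_poly G = alliance_poly H"
  shows "card (verts G) - max_degree G = card (verts H) - max_degree H"
    and "card (max_degree_verts G) = card (max_degree_verts H)"
proof -
  interpret G: graph G by fact
  interpret H: graph H by fact
  show "card (verts G) - max_degree G = card (verts H) - max_degree H"
    using G.alliance_poly_exponent_bounds(1) H.alliance_poly_exponent_bounds(1)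
      G.coeff_alliance_poly_lowest_nonzero H.coeff_alliance_poly_lowest_nonzero assms
    by (metis order_antisym)
  then show "card (max_degree_verts G) = card (max_degree_verts H)"
    using G.coeff_alliance_poly_lowest H.coeff_alliance_poly_lowest assms by (metis of_nat_eq_iff)
qed

section \<open>Complete graphs without one edge, up to isomorphism\<close>

text \<open>An intrinsic description, with no reference to an ambient complete graph, so that it
  also applies to a graph over another vertex type.\<close>

definition complete_minus_edge :: "'a pair_pre_digraph \<Rightarrow> 'a \<Rightarrow> 'a \<Rightarrow> bool" where
  "complete_minus_edge G x y \<longleftrightarrow> finite (pverts G) \<and> x \<in> pverts G \<and> y \<in> pverts G \<and> x \<noteq> y \<and>
     parcs G = {(a, b). a \<in> pverts G \<and> b \<in> pverts G \<and> a \<noteq> b} - {(x, y), (y, x)}"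

lemma complete_minus_edge_delete_edge:
  assumes "complete_digraph t (with_proj K)" "(u, v) \<in> parcs K"
  shows "complete_minus_edge (delete_edge K u v) u v"
  using assms by (auto simp: complete_minus_edge_def delete_edge_def complete_digraph_pair_def)

lemma complete_minus_edge_arc_iff:
  assumes "complete_minus_edge G x y"
  shows "(a, b) \<in> parcs G \<longleftrightarrow>
    a \<in> pverts G \<and> b \<in> pverts G \<and> a \<noteq> b \<and> (a, b) \<noteq> (x, y) \<and> (a, b) \<noteq> (y, x)"
  using assms by (auto simp: complete_minus_edge_def)

lemma complete_minus_edge_pair_graph:
  assumes "complete_minus_edge G x y"
  shows "pair_graph G"
proof -
  note parcs = complete_minus_edge_arc_iff[OF assms]
  have fin: "finite (pverts G)"
    using assms by (simp add: complete_minus_edge_def)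
  have "parcs G \<subseteq> pverts G \<times> pverts G"
    using parcs by auto
  from finite_subset[OF this] have "finite (parcs G)"
    using fin by simp
  moreover have "symmetric (with_proj G)"
    unfolding symmetric_def sym_def with_proj_simps parcs by blast
  moreover have "fst e \<in> pverts G" "snd e \<in> pverts G" "fst e \<noteq> snd e" if "e \<in> parcs G" for e
    using that parcs[of "fst e" "snd e"] by simp_all
  ultimately show ?thesis
    using fin by unfold_locales
qed

lemma complete_minus_edge_graph: "complete_minus_edge G x y \<Longrightarrow> graph (with_proj G)"
  by (rule pair_graph.pair_graphD_graph[OF complete_minus_edge_pair_graph])

text \<open>An isomorphism of digraphs also carries a map on arcs. Arcs being pairs of vertices
  here, \<open>map_prod f f\<close> is that map.\<close>

lemma digraph_isoI_bij_betw:
  assumes "pair_wf_digraph G" "pair_wf_digraph H"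
    and bij: "bij_betw f (pverts G) (pverts H)"
    and adj: "\<And>a b. a \<in> pverts G \<Longrightarrow> b \<in> pverts G \<Longrightarrow> (a, b) \<in> parcs G \<longleftrightarrow> (f a, f b) \<in> parcs H"
  shows "digraph_iso (with_proj G) (with_proj H)"
proof -
  interpret G: pair_wf_digraph G by fact
  interpret H: pair_wf_digraph H by fact
  let ?h = "\<lparr>iso_verts = f, iso_arcs = map_prod f f, iso_head = snd, iso_tail = fst\<rparr>"
  have sub: "parcs G \<subseteq> pverts G \<times> pverts G"
    using G.in_arcsD1 G.in_arcsD2 by auto
  have inj: "inj_on f (pverts G)" and img: "f ` pverts G = pverts H"
    using bij by (auto simp: bij_betw_def)
  have "inj_on (map_prod f f) (parcs G)"
    using inj_on_subset[OF map_prod_inj_on[OF inj inj] sub] .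
  moreover have "wf_digraph (with_proj G)" ..
  ultimately have "pre_digraph.digraph_isomorphism (with_proj G) ?h"
    unfolding pre_digraph.digraph_isomorphism_def using inj by simp
  moreover have "map_prod f f ` parcs G = parcs H"
  proof
    show "map_prod f f ` parcs G \<subseteq> parcs H"
      using adj sub by auto
    show "parcs H \<subseteq> map_prod f f ` parcs G"
    proof
      fix p assume p: "p \<in> parcs H"
      then obtain a b where "a \<in> pverts G" "b \<in> pverts G" "p = (f a, f b)"
        using img H.in_arcsD1 H.in_arcsD2 by (metis imageE surj_pair)
      then show "p \<in> map_prod f f ` parcs G"
        using adj p by force
    qed
  qed
  then have "with_proj H = app_iso ?h (with_proj G)"
    using img by (simp add: app_iso_def with_proj_def)
  ultimately show ?thesis unfolding digraph_iso_def by blast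
qed

text \<open>Adjacency depends only on equality and on the missing pair, so any bijection of the
  vertices taking \<open>x\<close> to \<open>u\<close> and \<open>y\<close> to \<open>v\<close> is
  an isomorphism.\<close>

lemma complete_minus_edge_iso:
  assumes G: "complete_minus_edge G x y" and H: "complete_minus_edge H u v"
    and card: "card (pverts G) = card (pverts H)"
  shows "digraph_iso (with_proj G) (with_proj H)"
proof -
  interpret G: pair_graph G using G by (rule complete_minus_edge_pair_graph)
  interpret H: pair_graph H using H by (rule complete_minus_edge_pair_graph)
  have "card (pverts G - {x, y}) = card (pverts H - {u, v})"
    using G H card by (simp add: complete_minus_edge_def card_Diff_subset)
  then obtain g where g: "bij_betw g (pverts G - {x, y}) (pverts H - {u, v})"
    using G H by (metis complete_minus_edge_def finite_Diff finite_same_card_bij)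
  \<comment> \<open>The bijection \<open>g\<close> of the remaining vertices is arbitrary; it is
    extended by the missing pair.\<close>
  define f where "f = g(x := u, y := v)"
  have "bij_betw f (pverts G - {x, y}) (pverts H - {u, v})"
    using g by (rule bij_betw_cong[THEN iffD1, rotated]) (auto simp: f_def)
  moreover have "bij_betw f {x, y} {u, v}"
    using G H by (auto simp: f_def complete_minus_edge_def bij_betw_def)
  ultimately have "bij_betw f ((pverts G - {x, y}) \<union> {x, y}) ((pverts H - {u, v}) \<union> {u, v})"
    by (rule bij_betw_combine) auto
  moreover have "pverts G - {x, y} \<union> {x, y} = pverts G" "pverts H - {u, v} \<union> {u, v} = pverts H"
    using G H by (auto simp: complete_minus_edge_def)
  ultimately have bij: "bij_betw f (pverts G) (pverts H)"
    by (simp only:)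
  have f: "f x = u" "f y = v"
    using G by (auto simp: f_def complete_minus_edge_def)
  show ?thesis
  proof (rule digraph_isoI_bij_betw[OF G.pair_wf_digraph H.pair_wf_digraph bij])
    fix a b assume ab: "a \<in> pverts G" "b \<in> pverts G"
    have inj: "f p = f q \<longleftrightarrow> p = q" if "p \<in> pverts G" "q \<in> pverts G" for p q
      using bij that by (auto simp: bij_betw_def inj_on_def)
    have "x \<in> pverts G" "y \<in> pverts G" using G by (auto simp: complete_minus_edge_def)
    then have "f p = u \<longleftrightarrow> p = x" "f p = v \<longleftrightarrow> p = y" if "p \<in> pverts G" for p
      using inj[OF that] f by metis+
    moreover have "f a \<in> pverts H" "f b \<in> pverts H"
      using bij ab by (auto simp: bij_betw_def)
    ultimately show "(a, b) \<in> parcs G \<longleftrightarrow> (f a, f b) \<in> parcs H"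
      unfolding complete_minus_edge_arc_iff[OF G] complete_minus_edge_arc_iff[OF H]
      using ab inj[OF ab] by simp
  qed
qed

section \<open>Degrees and exponents of a complete graph without one edge\<close>

lemma complete_minus_edge_out_degree:
  assumes "complete_minus_edge H u v" "w \<in> pverts H"
  shows "out_degree (with_proj H) w = (if w \<in> {u, v} then card (pverts H) - 2 else card (pverts H) - 1)"
proof -
  interpret H: graph "with_proj H"
    using assms(1) by (rule complete_minus_edge_graph)
  have uv: "u \<in> pverts H" "v \<in> pverts H" "u \<noteq> v"
    using assms(1) by (auto simp: complete_minus_edge_def)
  have "{z \<in> pverts H. (w, z) \<in> parcs H} = (if w \<in> {u, v} then pverts H - {u, v} else pverts H - {w})"
    unfolding complete_minus_edge_arc_iff[OF assms(1)] using assms(2) uv by auto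
  moreover have "out_degree (with_proj H) w = card {z \<in> pverts H. (w, z) \<in> parcs H}"
    using H.degree_in_verts[of w] by (simp add: degree_in_def)
  ultimately show ?thesis
    using uv assms(2) by (simp add: numeral_2_eq_2)
qed

text \<open>On two vertices nothing but the missing pair exists and both vertices are isolated. From
  three vertices on, there is a vertex outside the pair, and it is dominating.\<close>

lemma complete_minus_edge_max_degree:
  assumes "complete_minus_edge H u v"
  shows "card (pverts H) = 2 \<Longrightarrow> max_degree (with_proj H) = 0"
    and "card (pverts H) = 2 \<Longrightarrow> max_degree_verts (with_proj H) = pverts H"
    and "card (pverts H) \<ge> 3 \<Longrightarrow> max_degree (with_proj H) = card (pverts H) - 1"
    and "card (pverts H) \<ge> 3 \<Longrightarrow> max_degree_verts (with_proj H) = pverts H - {u, v}"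
proof -
  interpret H: graph "with_proj H"
    using assms(1) by (rule complete_minus_edge_graph)
  have uv: "{u, v} \<subseteq> pverts H" "u \<noteq> v" "finite (pverts H)"
    using assms by (auto simp: complete_minus_edge_def)
  note deg = complete_minus_edge_out_degree[OF assms]
  obtain m where m: "m \<in> pverts H" "out_degree (with_proj H) m = max_degree (with_proj H)"
    using H.max_degree_attained uv by auto
  {
    assume two: "card (pverts H) = 2"
    then have eq: "pverts H = {u, v}"
      using uv by (metis card_2_iff card_subset_eq)
    show "max_degree (with_proj H) = 0"
      using deg[OF m(1)] m two eq by simp
    then show "max_degree_verts (with_proj H) = pverts H"
      using deg two eq by (auto simp: max_degree_verts_def)
  next
    assume three: "card (pverts H) \<ge> 3"
    then have "\<not> pverts H \<subseteq> {u, v}"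
      using card_mono[of "{u, v}" "pverts H"] uv(2) by fastforce
    then obtain w where "w \<in> pverts H" "w \<notin> {u, v}" by auto
    then have "card (pverts H) - 1 \<le> max_degree (with_proj H)"
      using H.out_degree_le_max_degree[of w] deg[of w] by simp
    then show "max_degree (with_proj H) = card (pverts H) - 1"
      using H.max_degree_less_order uv(1) by force
    then show "max_degree_verts (with_proj H) = pverts H - {u, v}"
      using deg three by (auto simp: max_degree_verts_def split: if_splits)
  }
qed

text \<open>Let t be the order. If \<open>S\<close> contains \<open>u\<close> or \<open>v\<close>,
  the index is at most the degree t - 2 of that vertex. Otherwise \<open>S\<close> has at most t - 2
  elements, each with at most t - 3 neighbours in \<open>S\<close> and degree t - 1, so the index is
  at most t - 5.\<close>

lemma complete_minus_edge_exponent_le: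
  assumes H: "complete_minus_edge H u v" and e: "coeff (alliance_poly (with_proj H)) e \<noteq> 0"
  shows "e \<le> 2 * card (pverts H) - 2"
proof -
  interpret H: graph "with_proj H"
    using H by (rule complete_minus_edge_graph)
  have uv: "{u, v} \<subseteq> pverts H" "u \<noteq> v" "finite (pverts H)"
    using H by (auto simp: complete_minus_edge_def)
  have two: "card (pverts H) \<ge> 2"
    using card_mono[OF uv(3,1)] uv(2) by simp
  obtain S where S: "S \<subseteq> pverts H" "S \<noteq> {}"
    "int (card (pverts H)) + alliance_index (with_proj H) S = int e"
    using e by (auto simp: H.coeff_alliance_poly_nonzero_iff connected_sets_def)
  have "alliance_index (with_proj H) S \<le> int (card (pverts H)) - 2"
  proof (cases "S \<inter> {u, v} = {}")
    case False
    then obtain w where "w \<in> S" "w \<in> {u, v}" by auto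
    then show ?thesis
      using H.alliance_index_le[of S w] H.degree_in_le_out_degree[of S w] S(1) two
        complete_minus_edge_out_degree[OF H, of w] by auto
  next
    case True
    obtain w where w: "w \<in> S" using S by auto
    have "card S \<le> card (pverts H - {u, v})"
      using True S(1) uv by (intro card_mono) auto
    also have "\<dots> = card (pverts H) - 2"
      using uv by (simp add: card_Diff_subset)
    finally have "degree_in (with_proj H) S w < card (pverts H) - 2"
      using H.degree_in_less_card[of S w] w finite_subset[OF S(1) uv(3)] by simp
    moreover have "out_degree (with_proj H) w = card (pverts H) - 1"
      using complete_minus_edge_out_degree[OF H, of w] True w S(1) by auto
    ultimately show ?thesis
      using H.alliance_index_le[of S w] w S(1) by auto
  qed
  then show ?thesis using S(3) two by linarith
qed

text \<open>The whole vertex set gives the order plus some degree as an exponent. All degrees are at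
  least the order minus 2, and the upper bound on exponents forces equality.\<close>

lemma complete_minus_edge_top_exponent:
  assumes H: "complete_minus_edge H u v" and three: "card (pverts H) \<ge> 3"
  shows "coeff (alliance_poly (with_proj H)) (2 * card (pverts H) - 2) \<noteq> 0"
proof -
  interpret H: graph "with_proj H"
    using H by (rule complete_minus_edge_graph)
  obtain c where "c \<in> max_degree_verts (with_proj H)"
    using H.max_degree_verts_nonempty three by fastforce
  then have c: "c \<in> pverts H" "c \<notin> {u, v}"
    using complete_minus_edge_max_degree(4)[OF H three] by auto
  obtain w where w: "w \<in> pverts H"
    "coeff (alliance_poly (with_proj H)) (card (pverts H) + out_degree (with_proj H) w) \<noteq> 0"
    using H.alliance_poly_min_degree_exponent[of c] c H by (auto simp: complete_minus_edge_def)
  have "out_degree (with_proj H) w \<ge> card (pverts H) - 2"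
    using complete_minus_edge_out_degree[OF H w(1)] by auto
  moreover have "card (pverts H) + out_degree (with_proj H) w \<le> 2 * card (pverts H) - 2"
    using complete_minus_edge_exponent_le[OF H w(2)] .
  ultimately have "card (pverts H) + out_degree (with_proj H) w = 2 * card (pverts H) - 2"
    using three by linarith
  then show ?thesis using w(2) by simp
qed

section \<open>Recovering the graph from its polynomial\<close>

lemma alliance_poly_determines_empty_pair:
  assumes G: "pair_graph G" "pverts G \<noteq> {}" and H: "complete_minus_edge H u v"
    and two: "card (pverts H) = 2" and eq: "alliance_poly (with_proj G) = alliance_poly (with_proj H)"
  shows "card (pverts G) = card (pverts H) \<and> (\<exists>x y. complete_minus_edge G x y)"
proof -
  interpret G: graph "with_proj G"
    using G(1) by (rule pair_graph.pair_graphD_graph)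
  have arc: "a \<in> pverts G" "b \<in> pverts G" "a \<noteq> b" "(b, a) \<in> parcs G"
    if "(a, b) \<in> parcs G" for a b
    using that G.adj_in_verts[of a b] G.adj_not_same[of a] G.graph_symmetric[of a b] by auto
  interpret H: graph "with_proj H"
    using H by (rule complete_minus_edge_graph)
  have "pverts H \<noteq> {}" using two by auto
  then have low: "card (pverts G) - max_degree (with_proj G) = 2"
      and num: "card (max_degree_verts (with_proj G)) = 2"
    using alliance_poly_eq_lowest[OF pair_graph.pair_graphD_graph[OF G(1)] _ complete_minus_edge_graph[OF H] _ eq] G(2)
      complete_minus_edge_max_degree(1,2)[OF H two] two by auto
  \<comment> \<open>No exponent exceeds 2, which is also the lowest one. The singleton of
    \<open>w\<close> therefore has exponent 2, so its degree is maximal.\<close>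
  have "out_degree (with_proj G) w = max_degree (with_proj G)" if "w \<in> pverts G" for w
  proof -
    have "card (pverts G) - out_degree (with_proj G) w \<le> 2"
      using H.alliance_poly_exponent_bounds(2)[of "card (pverts G) - out_degree (with_proj G) w"]
        G.alliance_poly_singleton_exponent[of w] that eq
        complete_minus_edge_max_degree(1)[OF H two] two by simp
    then show ?thesis
      using low G.out_degree_le_max_degree[of w] that by simp
  qed
  then have "max_degree_verts (with_proj G) = pverts G"
    by (auto simp: max_degree_verts_def)
  then have card: "card (pverts G) = 2" and max0: "max_degree (with_proj G) = 0"
    using num low by auto
  have "parcs G = {}"
  proof (rule ccontr)
    assume "parcs G \<noteq> {}"
    then obtain a b where ab: "(a, b) \<in> parcs G" by auto
    then have "a \<in> pverts G" "b \<in> pverts G"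
      using arc by auto
    then have "degree_in (with_proj G) (pverts G) a \<noteq> 0"
      using ab G.finite_verts by (auto simp: degree_in_def card_gt_0_iff)
    then show False
      using G.out_degree_le_max_degree[of a] G.degree_in_verts[of a] max0 \<open>a \<in> pverts G\<close> by simp
  qed
  moreover obtain x y where "pverts G = {x, y}" "x \<noteq> y"
    using card by (auto simp: card_2_iff)
  ultimately have "complete_minus_edge G x y"
    by (auto simp: complete_minus_edge_def)
  then show ?thesis using card two by auto
qed

lemma alliance_poly_determines_complete_minus_edge:
  assumes G: "pair_graph G" "pverts G \<noteq> {}" and H: "complete_minus_edge H u v"
    and three: "card (pverts H) \<ge> 3" and eq: "alliance_poly (with_proj G) = alliance_poly (with_proj H)"
  shows "card (pverts G) = card (pverts H) \<and> (\<exists>x y. complete_minus_edge G x y)"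
proof -
  interpret G: graph "with_proj G"
    using G(1) by (rule pair_graph.pair_graphD_graph)
  have arc: "a \<in> pverts G" "b \<in> pverts G" "a \<noteq> b" "(b, a) \<in> parcs G"
    if "(a, b) \<in> parcs G" for a b
    using that G.adj_in_verts[of a b] G.adj_not_same[of a] G.graph_symmetric[of a b] by auto
  interpret H: graph "with_proj H"
    using H by (rule complete_minus_edge_graph)
  let ?n = "card (pverts G)" and ?t = "card (pverts H)"
  let ?deg = "out_degree (with_proj G)"
  define M where "M = max_degree_verts (with_proj G)"
  have uv: "{u, v} \<subseteq> pverts H" "u \<noteq> v" "finite (pverts H)"
    using H by (auto simp: complete_minus_edge_def)
  have "verts (with_proj G) \<noteq> {}" "verts (with_proj H) \<noteq> {}"
    using G(2) uv(1) by auto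
  note lowest_eq = alliance_poly_eq_lowest[OF pair_graph.pair_graphD_graph[OF G(1)] this(1)
    complete_minus_edge_graph[OF H] this(2) eq]
  have "card (pverts H - {u, v}) = ?t - 2"
    using uv by (subst card_Diff_subset) auto
  then have card_M: "card M = ?t - 2"
    by (simp only: M_def lowest_eq(2) complete_minus_edge_max_degree(4)[OF H three])
  have lowest: "?n - max_degree (with_proj G) = 1"
    using lowest_eq(1) complete_minus_edge_max_degree(3)[OF H three] three by simp
  \<comment> \<open>Lowest exponent 1 means that the vertices of maximum degree, collected in
    \<open>M\<close>, are exactly the dominating ones.\<close>
  have maxdeg: "max_degree (with_proj G) = ?n - 1"
    using lowest by simp
  have M_iff: "a \<in> M \<longleftrightarrow> (\<forall>b \<in> pverts G - {a}. (a, b) \<in> parcs G)" if "a \<in> pverts G" for a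
    using G.out_degree_eq_order_minus_1_iff[of a] that by (simp add: M_def max_degree_verts_def maxdeg)
  have M_sub: "M \<subseteq> pverts G" by (auto simp: M_def max_degree_verts_def)
  have adj: "(a, b) \<in> parcs G \<and> (b, a) \<in> parcs G" if "a \<in> M" "b \<in> pverts G" "a \<noteq> b" for a b
    using M_iff[of a] that M_sub arc(4) by blast
  \<comment> \<open>The exponent \<open>2 * ?t - 2\<close> is at most \<open>?n + (?n - 1)\<close>.
    The excess of one is lost by parity.\<close>
  have ge: "?t \<le> ?n"
    using G.alliance_poly_exponent_bounds(2)[of "2 * ?t - 2"]
      complete_minus_edge_top_exponent[OF H three] eq maxdeg three by simp
  obtain c where c: "c \<in> M"
    using G.max_degree_verts_nonempty G(2) unfolding M_def with_proj_simps by blast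
  obtain w where w: "w \<in> pverts G" "coeff (alliance_poly (with_proj G)) (?n + ?deg w) \<noteq> 0"
    using G.alliance_poly_min_degree_exponent[of c] c adj M_sub unfolding with_proj_simps by blast
  \<comment> \<open>A dominating \<open>w\<close> has degree \<open>?n - 1\<close>; any other
    \<open>w\<close> is adjacent to all \<open>?t - 2\<close> elements of \<open>M\<close>.\<close>
  have "?t - 2 \<le> ?deg w"
  proof (cases "w \<in> M")
    case True
    then show ?thesis using ge by (simp add: M_def max_degree_verts_def maxdeg)
  next
    case False
    then have "M \<subseteq> {z \<in> pverts G. (w, z) \<in> parcs G}"
      using adj w M_sub by auto
    then have "card M \<le> degree_in (with_proj G) (pverts G) w"
      unfolding degree_in_def using G.finite_verts by (auto intro: card_mono)
    then show ?thesis using G.degree_in_verts[of w] card_M by simp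
  qed
  moreover have "?n + ?deg w \<le> 2 * ?t - 2"
    using complete_minus_edge_exponent_le[OF H] w(2) eq by simp
  ultimately have n: "?n = ?t" using ge three by linarith
  have "card (pverts G - M) = 2"
    using M_sub card_M n three G.finite_verts finite_subset[OF M_sub]
    by (simp add: card_Diff_subset)
  then obtain x y where xy: "pverts G - M = {x, y}" "x \<noteq> y"
    by (auto simp: card_2_iff)
  then have xy': "x \<in> pverts G" "y \<in> pverts G" "x \<notin> M" "y \<notin> M" by auto
  \<comment> \<open>Since \<open>x\<close> is not dominating, it misses some vertex. That vertex
    cannot lie in \<open>M\<close>, which leaves only \<open>y\<close>.\<close>
  have "\<exists>b \<in> pverts G - {x}. (x, b) \<notin> parcs G"
    using M_iff xy' by auto
  then have nxy: "(x, y) \<notin> parcs G"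
    using adj xy xy' by blast
  then have nyx: "(y, x) \<notin> parcs G"
    using arc(4) by blast
  have "parcs G = {(a, b). a \<in> pverts G \<and> b \<in> pverts G \<and> a \<noteq> b} - {(x, y), (y, x)}"
  proof (intro set_eqI iffI)
    fix p assume "p \<in> parcs G"
    then show "p \<in> {(a, b). a \<in> pverts G \<and> b \<in> pverts G \<and> a \<noteq> b} - {(x, y), (y, x)}"
      using nxy nyx arc by (cases p) auto
  next
    fix p assume "p \<in> {(a, b). a \<in> pverts G \<and> b \<in> pverts G \<and> a \<noteq> b} - {(x, y), (y, x)}"
    then obtain a b where p: "p = (a, b)" "a \<in> pverts G" "b \<in> pverts G" "a \<noteq> b"
      and "(a, b) \<noteq> (x, y)" "(a, b) \<noteq> (y, x)"
      by auto
    \<comment> \<open>A pair of distinct vertices other than the missing one has a member in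
      \<open>M\<close>, and that member is adjacent to everything else.\<close>
    then have "\<not> (a \<in> {x, y} \<and> b \<in> {x, y})" by auto
    then have "a \<in> M \<or> b \<in> M"
      using p xy(1) by blast
    then show "p \<in> parcs G" using adj p by blast
  qed
  then have "complete_minus_edge G x y"
    using xy xy' G.finite_verts by (simp add: complete_minus_edge_def)
  then show ?thesis using n by auto
qed

theorem theorem3p12:
  fixes t :: nat
    and K :: "'a pair_pre_digraph" and u v :: 'a
    and \<Gamma> :: "'b pair_pre_digraph"
  assumes "t \<ge> 2"
    and "complete_digraph t (with_proj K)"
    and "(u, v) \<in> parcs K"
    and "pair_graph \<Gamma>" and "pverts \<Gamma> \<noteq> {}"
    and "alliance_poly (with_proj \<Gamma>) = alliance_poly (with_proj (delete_edge K u v))"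
  shows "digraph_iso (with_proj \<Gamma>) (with_proj (delete_edge K u v))"
proof -
  let ?H = "delete_edge K u v"
  have H: "complete_minus_edge ?H u v"
    using assms(2,3) by (rule complete_minus_edge_delete_edge)
  have "card (pverts ?H) = t"
    using assms(2) by (simp add: delete_edge_def complete_digraph_pair_def)
  then have "card (pverts ?H) = 2 \<or> card (pverts ?H) \<ge> 3"
    using assms(1) by auto
  then obtain x y where "card (pverts \<Gamma>) = card (pverts ?H)" "complete_minus_edge \<Gamma> x y"
    using alliance_poly_determines_empty_pair[OF assms(4,5) H _ assms(6)]
      alliance_poly_determines_complete_minus_edge[OF assms(4,5) H _ assms(6)] by blast
  then show ?thesis
    using H by (intro complete_minus_edge_iso)
qed

end
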